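(* For all integers $p,q>0$, the class of all graphs whose complements lie in $\mathcal{F}^{p,q}$ (the class of graphs that are both $F_S^{p,q}$-free and $F_K^{p,q}$-free) has the clique-stable set separation property.
   Context: All graphs are finite and simple. A clique is a set of pairwise adjacent vertices; a stable set is a set of pairwise non-adjacent vertices. For disjoint vertex sets $X,Y$: $X$ is complete to $Y$ if every vertex of $X$ is adjacent to every vertex of $Y$; $X$ and $Y$ are matched if every vertex of $X$ has exactly one neighbor in $Y$ and every vertex of $Y$ has exactly one neighbor in $X$. A graph $G$ is $H$-free if no induced subgraph of $G$ is isomorphic to $H$. The graph $F_S^{p,q}$ has vertex set $K\cup S_1\cup S_2\cup S_3$ (pairwise disjoint), where $K$ is a clique, $S_1,S_2,S_3$ are stable sets, $|K|=|S_1|=p$ and $K$ and $S_1$ are matched, $|S_2|=|S_3|=q$ and $S_2$ and $S_3$ are matched, $K$ is complete to $S_2$, and there are no other edges. The graph $F_K^{p,q}$ is obtained from $F_S^{p,q}$ by making all pairs of vertices of $S_3$ adjacent. A class $\mathcal{C}$ of graphs closed under taking induced subgraphs has the clique-stable set separation property if there exists $c\in\mathbb{N}$ such that for every $G\in\mathcal{C}$ there is a collection $\mathcal{P}$ of partitions $(X,Y)$ of $V(G)$ with $|\mathcal{P}|\le |V(G)|^c$ such that for every clique $K$ and stable set $S$ of $G$ with $K\cap S=\emptyset$ there is $(X,Y)\in\mathcal{P}$ with $K\subseteq X$ and $S\subseteq Y$.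
   Formalization: The bound |P| ≤ |V(G)|^c is required only for graphs with at least two vertices; for the one-vertex graph, which lies in the class, the literal bound 1^c = 1 fails because ({v}, ∅) and (∅, {v}) need different partitions. *)

theory Defs
  imports "HOL-Library.Ramsey"
begin

type_synonym 'a ugraph = "'a set \<times> 'a set set"

abbreviation verts :: "'a ugraph \<Rightarrow> 'a set" where
  "verts G \<equiv> fst G"

abbreviation edges :: "'a ugraph \<Rightarrow> 'a set set" where
  "edges G \<equiv> snd G"

definition simple_graph :: "'a ugraph \<Rightarrow> bool" where
  "simple_graph G \<longleftrightarrow> finite (verts G) \<and> edges G \<subseteq> [verts G]\<^bsup>2\<^esup>"

definition complement :: "'a ugraph \<Rightarrow> 'a ugraph" where
  "complement G = (verts G, [verts G]\<^bsup>2\<^esup> - edges G)"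

definition induced :: "'a ugraph \<Rightarrow> 'a set \<Rightarrow> 'a ugraph" where
  "induced G A = (A, {e \<in> edges G. e \<subseteq> A})"

definition graph_iso :: "'a ugraph \<Rightarrow> 'b ugraph \<Rightarrow> bool" where
  "graph_iso G H \<longleftrightarrow> (\<exists>f. bij_betw f (verts G) (verts H) \<and>
     (\<forall>u\<in>verts G. \<forall>v\<in>verts G. {u, v} \<in> edges G \<longleftrightarrow> {f u, f v} \<in> edges H))"

definition free_of :: "'b ugraph \<Rightarrow> 'a ugraph \<Rightarrow> bool" where
  "free_of H G \<longleftrightarrow> \<not> (\<exists>A\<subseteq>verts G. graph_iso (induced G A) H)"

definition clique_in :: "'a ugraph \<Rightarrow> 'a set \<Rightarrow> bool" where
  "clique_in G K \<longleftrightarrow> K \<subseteq> verts G \<and> clique K (edges G)"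

definition stable_in :: "'a ugraph \<Rightarrow> 'a set \<Rightarrow> bool" where
  "stable_in G S \<longleftrightarrow> S \<subseteq> verts G \<and> indep S (edges G)"

definition complete_to :: "'a ugraph \<Rightarrow> 'a set \<Rightarrow> 'a set \<Rightarrow> bool" where
  "complete_to G X Y \<longleftrightarrow> (\<forall>x\<in>X. \<forall>y\<in>Y. {x, y} \<in> edges G)"

definition matched :: "'a ugraph \<Rightarrow> 'a set \<Rightarrow> 'a set \<Rightarrow> bool" where
  "matched G X Y \<longleftrightarrow>
     (\<forall>x\<in>X. \<exists>!y. y \<in> Y \<and> {x, y} \<in> edges G) \<and>
     (\<forall>y\<in>Y. \<exists>!x. x \<in> X \<and> {x, y} \<in> edges G)"

text \<open>The graphs $F_S^{p,q}$ and $F_K^{p,q}$ are given by one concrete representative each; both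
  matchings pair vertices with equal index. The lemmas \<open>F_S_shape\<close> and \<open>F_K_shape\<close> below check the
  representatives against the description by cliques, stable sets and matchings.\<close>

datatype F_vertex = VK nat | VS1 nat | VS2 nat | VS3 nat

definition F_S :: "nat \<Rightarrow> nat \<Rightarrow> F_vertex ugraph" where
  "F_S p q =
    (VK ` {..<p} \<union> VS1 ` {..<p} \<union> VS2 ` {..<q} \<union> VS3 ` {..<q},
     [VK ` {..<p}]\<^bsup>2\<^esup>
       \<union> {{VK i, VS1 i} |i. i < p}
       \<union> {{VS2 j, VS3 j} |j. j < q}
       \<union> {{VK i, VS2 j} |i j. i < p \<and> j < q})"

definition F_K :: "nat \<Rightarrow> nat \<Rightarrow> F_vertex ugraph" where
  "F_K p q = (verts (F_S p q), edges (F_S p q) \<union> [VS3 ` {..<q}]\<^bsup>2\<^esup>)"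

definition F_class :: "nat \<Rightarrow> nat \<Rightarrow> 'a ugraph set" where
  "F_class p q = {G. simple_graph G \<and> free_of (F_S p q) G \<and> free_of (F_K p q) G}"

definition hereditary :: "'a ugraph set \<Rightarrow> bool" where
  "hereditary C \<longleftrightarrow> (\<forall>G\<in>C. \<forall>A\<subseteq>verts G. induced G A \<in> C)"

definition bipartitions :: "'a set \<Rightarrow> ('a set \<times> 'a set) set" where
  "bipartitions V = {(X, Y). X \<union> Y = V \<and> X \<inter> Y = {}}"

text \<open>The bound \<open>card P \<le> card (verts G) ^ c\<close> is imposed on graphs with at least two vertices. On
  the one-vertex graph it reads \<open>card P \<le> 1\<close> for every \<open>c\<close>, but the pairs \<open>K = {v}\<close>, \<open>S = {}\<close> and
  \<open>K = {}\<close>, \<open>S = {v}\<close> need two different partitions; on the graph with no vertices it would force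
  \<open>c = 0\<close>. Without the restriction no class containing the one-vertex graph would have the
  property.\<close>

definition clique_stable_separation :: "'a ugraph set \<Rightarrow> bool" where
  "clique_stable_separation C \<longleftrightarrow> hereditary C \<and>
     (\<exists>c::nat. \<forall>G\<in>C. 2 \<le> card (verts G) \<longrightarrow>
        (\<exists>P \<subseteq> bipartitions (verts G).
           card P \<le> card (verts G) ^ c \<and>
           (\<forall>K S. clique_in G K \<and> stable_in G S \<and> K \<inter> S = {} \<longrightarrow>
              (\<exists>(X, Y)\<in>P. K \<subseteq> X \<and> S \<subseteq> Y))))"

lemma F_S_shape:
  fixes p q :: nat
  defines "K \<equiv> VK ` {..<p}" and "S1 \<equiv> VS1 ` {..<p}"
    and "S2 \<equiv> VS2 ` {..<q}" and "S3 \<equiv> VS3 ` {..<q}"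
  shows "simple_graph (F_S p q)"
    and "verts (F_S p q) = K \<union> S1 \<union> S2 \<union> S3"
    and "K \<inter> S1 = {}" "K \<inter> S2 = {}" "K \<inter> S3 = {}" "S1 \<inter> S2 = {}" "S1 \<inter> S3 = {}" "S2 \<inter> S3 = {}"
    and "card K = p" "card S1 = p" "card S2 = q" "card S3 = q"
    and "clique_in (F_S p q) K"
    and "stable_in (F_S p q) S1" "stable_in (F_S p q) S2" "stable_in (F_S p q) S3"
    and "matched (F_S p q) K S1" "matched (F_S p q) S2 S3"
    and "complete_to (F_S p q) K S2"
    and "\<And>u v. u \<in> S1 \<Longrightarrow> v \<in> S2 \<union> S3 \<Longrightarrow> {u, v} \<notin> edges (F_S p q)"
    and "\<And>u v. u \<in> K \<Longrightarrow> v \<in> S3 \<Longrightarrow> {u, v} \<notin> edges (F_S p q)"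
  unfolding K_def S1_def S2_def S3_def
  by (auto simp: simple_graph_def F_S_def card_image inj_on_def clique_in_def stable_in_def
      clique_def indep_def nsets_def matched_def complete_to_def doubleton_eq_iff card_insert_if)

lemma F_K_shape:
  fixes p q :: nat
  defines "S3 \<equiv> VS3 ` {..<q}"
  shows "simple_graph (F_K p q)"
    and "verts (F_K p q) = verts (F_S p q)"
    and "\<And>u v. {u, v} \<in> edges (F_K p q) \<longleftrightarrow>
           {u, v} \<in> edges (F_S p q) \<or> u \<in> S3 \<and> v \<in> S3 \<and> u \<noteq> v"
  using F_S_shape(1)[of p q] unfolding S3_def
  by (auto simp: F_K_def F_S_def simple_graph_def nsets_def card_insert_if)

end

theory Submission
  imports Defs
begin

text \<open>The separation property is invariant under complementation, so let \<open>K\<close> be a clique and \<open>S\<close> a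
  stable set of a graph in $\mathcal{F}^{p,q}$. If some vertex of \<open>K\<close> has no neighbour in \<open>S\<close>, its
  closed neighbourhood separates. Otherwise let \<open>Y \<subseteq> S\<close> be minimal such that every vertex of \<open>K\<close> has
  a neighbour in \<open>Y\<close>; if \<open>|Y| \<le> p\<close>, the neighbourhood of \<open>Y\<close> separates. Otherwise pick \<open>A \<subseteq> Y\<close> of
  size \<open>p\<close>, matched by minimality with a set \<open>K' \<subseteq> K\<close> of private neighbours. Let \<open>W\<close> be the set of
  vertices with no neighbour in \<open>A \<union> K'\<close>, and \<open>T\<close> the set of vertices of \<open>S - A\<close> complete to \<open>K'\<close>.
  A minimal \<open>T' \<subseteq> T\<close> with the same neighbours in \<open>W\<close> as \<open>T\<close> is matched with a subset of \<open>W\<close>, so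
  Ramsey's theorem and the two excluded graphs bound its size. A vertex of \<open>K\<close> without neighbours
  in \<open>A\<close> has a neighbour in \<open>Y - A \<subseteq> W\<close>, which has no neighbour in \<open>T'\<close> because \<open>S\<close> is stable;
  no vertex of \<open>T\<close> has such a neighbour. Hence \<open>A\<close>, \<open>K'\<close> and \<open>T'\<close> determine a separating cut.\<close>

section \<open>Minimal dominating sets and private neighbours\<close>

text \<open>Take \<open>T'\<close> of least cardinality among the subsets of \<open>T\<close> that
  dominate whatever \<open>T\<close> dominates in \<open>D\<close>. Dropping \<open>t\<close> from
  it must lose some vertex of \<open>D\<close>, and \<open>h t\<close> is such a vertex. It serves
  twice below: for \<open>S\<close> against \<open>K\<close>, and for the candidates for $S_2$
  against those for $S_3$.\<close>

lemma minimal_dominating_subset: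
  assumes "finite T"
  obtains T' h where "T' \<subseteq> T"
    and "\<And>w t. w \<in> D \<Longrightarrow> t \<in> T \<Longrightarrow> R t w \<Longrightarrow> \<exists>t'\<in>T'. R t' w"
    and "\<And>t. t \<in> T' \<Longrightarrow> h t \<in> D"
    and "\<And>t t'. t \<in> T' \<Longrightarrow> t' \<in> T' \<Longrightarrow> R t' (h t) \<longleftrightarrow> t' = t"
proof -
  define dom where "dom = (\<lambda>X. X \<subseteq> T \<and> (\<forall>w\<in>D. (\<exists>t\<in>T. R t w) \<longrightarrow> (\<exists>t\<in>X. R t w)))"
  have "dom T" by (auto simp: dom_def)
  then obtain T' where T': "dom T'" and minimal: "\<And>X. dom X \<Longrightarrow> card T' \<le> card X"
    using ex_has_least_nat[of dom T card] by blast
  have "\<exists>w\<in>D. \<forall>t'\<in>T'. R t' w \<longleftrightarrow> t' = t" if t: "t \<in> T'" for t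
  proof -
    have "finite T'" using T' assms finite_subset by (auto simp: dom_def)
    then have "card (T' - {t}) < card T'" using t by (rule card_Diff1_less)
    then have "\<not> dom (T' - {t})" using minimal leD by blast
    then show ?thesis using T' unfolding dom_def by blast
  qed
  then obtain h where "\<forall>t\<in>T'. h t \<in> D \<and> (\<forall>t'\<in>T'. R t' (h t) \<longleftrightarrow> t' = t)"
    by metis
  then show thesis using T' that[of T' h] unfolding dom_def by blast
qed

section \<open>Copies of the two excluded graphs\<close>

lemma not_free_of_embedding:
  assumes inj: "inj_on g (verts F)" and sub: "g ` verts F \<subseteq> verts H"
    and adj: "\<And>u v. u \<in> verts F \<Longrightarrow> v \<in> verts F \<Longrightarrow> {g u, g v} \<in> edges H \<longleftrightarrow> {u, v} \<in> edges F"
  shows "\<not> free_of F H"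
proof -
  let ?f = "inv_into (verts F) g"
  have "bij_betw ?f (g ` verts F) (verts F)"
    using inj by (simp add: bij_betw_inv_into inj_on_imp_bij_betw)
  moreover have "{u, v} \<in> edges (induced H (g ` verts F)) \<longleftrightarrow> {?f u, ?f v} \<in> edges F"
    if "u \<in> g ` verts F" "v \<in> g ` verts F" for u v
    using that adj inj by (auto simp: induced_def)
  ultimately have "graph_iso (induced H (g ` verts F)) F"
    unfolding graph_iso_def by (intro exI[of _ ?f]) (auto simp: induced_def)
  then show ?thesis using sub unfolding free_of_def by blast
qed

text \<open>In the copy, \<open>A\<close> is $S_1$, its private neighbours under \<open>k\<close>
  form $K$, \<open>B\<close> is $S_2$, and its private neighbours under \<open>w\<close> form $S_3$.
  The hypotheses settle every adjacency except those within $S_3$; there a clique yields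
  \<open>F_K\<close> and a stable set yields \<open>F_S\<close>.\<close>

lemma F_S_or_F_K_embeds:
  fixes H :: "'a ugraph"
  assumes H: "simple_graph H"
    and indep: "stable_in H (A \<union> B)" and disj: "A \<inter> B = {}"
    and card: "card A = p" "card B = q"
    and K_clique: "\<And>a a'. a \<in> A \<Longrightarrow> a' \<in> A \<Longrightarrow> a \<noteq> a' \<Longrightarrow> {k a, k a'} \<in> edges H"
    and AK: "\<And>a a'. a \<in> A \<Longrightarrow> a' \<in> A \<Longrightarrow> {a', k a} \<in> edges H \<longleftrightarrow> a' = a"
    and KB: "\<And>a b. a \<in> A \<Longrightarrow> b \<in> B \<Longrightarrow> {b, k a} \<in> edges H"
    and BW: "\<And>b b'. b \<in> B \<Longrightarrow> b' \<in> B \<Longrightarrow> {b', w b} \<in> edges H \<longleftrightarrow> b' = b"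
    and AW: "\<And>a b. a \<in> A \<Longrightarrow> b \<in> B \<Longrightarrow> {a, w b} \<notin> edges H"
    and KW: "\<And>a b. a \<in> A \<Longrightarrow> b \<in> B \<Longrightarrow> {k a, w b} \<notin> edges H"
    and W: "clique (w ` B) (edges H) \<or> indep (w ` B) (edges H)"
  shows "\<not> free_of (F_S p q) H \<or> \<not> free_of (F_K p q) H"
proof -
  have E: "u \<noteq> v \<and> u \<in> verts H \<and> v \<in> verts H" if "{u, v} \<in> edges H" for u v
    using that H by (auto simp: simple_graph_def nsets_def card_insert_if split: if_splits)
  have loop: "{u} \<notin> edges H" for u using E[of u u] by auto
  have fin: "finite A" "finite B"
    using indep H by (auto simp: stable_in_def simple_graph_def intro: finite_subset)
  obtain a where a: "bij_betw a {..<p} A"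
    using ex_bij_betw_nat_finite[OF fin(1)] card by (auto simp: atLeast0LessThan)
  obtain b where b: "bij_betw b {..<q} B"
    using ex_bij_betw_nat_finite[OF fin(2)] card by (auto simp: atLeast0LessThan)
  have aA: "a i \<in> A" if "i < p" for i using a that by (auto simp: bij_betw_def)
  have bB: "b i \<in> B" if "i < q" for i using b that by (auto simp: bij_betw_def)
  have a_eq: "a i = a j \<longleftrightarrow> i = j" if "i < p" "j < p" for i j
    using a that by (auto simp: bij_betw_def inj_on_def)
  have b_eq: "b i = b j \<longleftrightarrow> i = j" if "i < q" "j < q" for i j
    using b that by (auto simp: bij_betw_def inj_on_def)
  have AB: "{u, v} \<notin> edges H" if "u \<in> A \<union> B" "v \<in> A \<union> B" for u v
    using indep that E[of u v] by (auto simp: stable_in_def indep_def)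
  \<comment> \<open>Injectivity of \<open>k\<close> and \<open>w\<close> and disjointness of the
    four parts follow from adjacency alone: a private neighbour determines its owner,
    \<open>k x\<close> and \<open>w x\<close> are adjacent to a member of the stable set
    \<open>A \<union> B\<close>, and \<open>x\<close> sees \<open>k x\<close> but not
    \<open>w y\<close>.\<close>
  have ka: "{x, k x} \<in> edges H" if "x \<in> A" for x using AK that by blast
  have wb: "{x, w x} \<in> edges H" if "x \<in> B" for x using BW that by blast
  have kAB: "k x \<notin> A \<union> B" if "x \<in> A" for x using ka[OF that] AB that by blast
  have wAB: "w x \<notin> A \<union> B" if "x \<in> B" for x using wb[OF that] AB that by blast
  have kw: "k x \<noteq> w y" if "x \<in> A" "y \<in> B" for x y using ka AW that by metis
  have k_eq: "k x = k y \<longleftrightarrow> x = y" if "x \<in> A" "y \<in> A" for x y using ka AK that by metis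
  have w_eq: "w x = w y \<longleftrightarrow> x = y" if "x \<in> B" "y \<in> B" for x y using wb BW that by metis
  define g where "g = (\<lambda>v. case v of VK i \<Rightarrow> k (a i) | VS1 i \<Rightarrow> a i | VS2 i \<Rightarrow> b i | VS3 i \<Rightarrow> w (b i))"
  have g_simps [simp]: "g (VK i) = k (a i)" "g (VS1 i) = a i" "g (VS2 i) = b i" "g (VS3 i) = w (b i)"
    for i by (simp_all add: g_def)
  let ?V = "verts (F_S p q)"
  have V: "?V = VK ` {..<p} \<union> VS1 ` {..<p} \<union> VS2 ` {..<q} \<union> VS3 ` {..<q}"
    by (simp add: F_S_def)
  have sub: "g ` ?V \<subseteq> verts H"
  proof -
    have "x \<in> verts H \<and> k x \<in> verts H" if "x \<in> A" for x using E[OF ka[OF that]] by simp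
    moreover have "x \<in> verts H \<and> w x \<in> verts H" if "x \<in> B" for x using E[OF wb[OF that]] by simp
    ultimately show ?thesis unfolding V by (auto simp del: split_paired_All simp: aA bB)
  qed
  have ab: "a i \<noteq> b j" if "i < p" "j < q" for i j
    using aA[OF that(1)] bB[OF that(2)] disj by auto
  have ka_neq: "k (a i) \<noteq> a j" if "i < p" "j < p" for i j
    using kAB[OF aA[OF that(1)]] aA[OF that(2)] by auto
  have kb_neq: "k (a i) \<noteq> b j" if "i < p" "j < q" for i j
    using kAB[OF aA[OF that(1)]] bB[OF that(2)] by auto
  have wa_neq: "w (b i) \<noteq> a j" if "i < q" "j < p" for i j
    using wAB[OF bB[OF that(1)]] aA[OF that(2)] by auto
  have wb_neq: "w (b i) \<noteq> b j" if "i < q" "j < q" for i j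
    using wAB[OF bB[OF that(1)]] bB[OF that(2)] by auto
  have kw_neq: "k (a i) \<noteq> w (b j)" if "i < p" "j < q" for i j
    using that by (intro kw aA bB)
  note neqs = ab ka_neq kb_neq wa_neq wb_neq kw_neq
  have inj: "inj_on g ?V"
  proof (rule inj_onI)
    fix u v assume "u \<in> ?V" "v \<in> ?V" "g u = g v"
    then show "u = v"
      unfolding V
      by (elim UnE imageE) (simp_all add: a_eq b_eq k_eq w_eq aA bB neqs neqs[THEN not_sym])
  qed
  \<comment> \<open>For two vertices of $S_3$ the right side merely repeats the left one, since
    \<open>F_S\<close> has no edge there. This leaves the pair open, so that both outcomes of
    \<open>W\<close> can share the case analysis.\<close>
  have adj: "{g u, g v} \<in> edges H \<longleftrightarrow>
      {u, v} \<in> edges (F_S p q) \<or> (u \<in> VS3 ` {..<q} \<and> v \<in> VS3 ` {..<q} \<and> {g u, g v} \<in> edges H)"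
    if uv: "u \<in> ?V" "v \<in> ?V" for u v
  proof -
    have VK_adj: "{g (VK i), g v} \<in> edges H \<longleftrightarrow> {VK i, v} \<in> edges (F_S p q)"
      if "i < p" "v \<in> ?V" for i v
      using that K_clique[OF aA aA] AK[OF aA aA] KB[OF aA bB] KW[OF aA bB] loop
      by (auto simp: V F_S_def doubleton_eq_iff nsets_def card_insert_if a_eq insert_commute)
    have VS1_adj: "{g (VS1 i), g v} \<in> edges H \<longleftrightarrow> {VS1 i, v} \<in> edges (F_S p q)"
      if "i < p" "v \<in> ?V - VK ` {..<p}" for i v
      using that AW[OF aA bB] AB aA bB loop
      by (auto simp: V F_S_def doubleton_eq_iff nsets_def card_insert_if)
    have VS2_adj: "{g (VS2 i), g v} \<in> edges H \<longleftrightarrow> {VS2 i, v} \<in> edges (F_S p q)"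
      if "i < q" "v \<in> VS2 ` {..<q} \<union> VS3 ` {..<q}" for i v
      using that BW[OF bB bB] AB aA bB loop
      by (auto simp: V F_S_def doubleton_eq_iff nsets_def card_insert_if b_eq)
    have VS3: "{u, v} \<notin> edges (F_S p q)" if "u \<in> VS3 ` {..<q}" "v \<in> VS3 ` {..<q}" for u v
      using that by (auto simp: F_S_def doubleton_eq_iff nsets_def card_insert_if)
    consider i where "u = VK i" "i < p" | i where "v = VK i" "i < p"
      | i where "u = VS1 i" "i < p" "v \<in> ?V - VK ` {..<p}"
      | i where "v = VS1 i" "i < p" "u \<in> ?V - VK ` {..<p}"
      | i where "u = VS2 i" "i < q" "v \<in> VS2 ` {..<q} \<union> VS3 ` {..<q}"
      | i where "v = VS2 i" "i < q" "u \<in> VS2 ` {..<q} \<union> VS3 ` {..<q}"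
      | "u \<in> VS3 ` {..<q}" "v \<in> VS3 ` {..<q}"
      using uv unfolding V by (elim UnE imageE) auto
    then show ?thesis
    proof cases
      case 1 then show ?thesis using VK_adj uv by blast
    next
      case 2 then show ?thesis using VK_adj[of i u] uv by (auto simp: insert_commute)
    next
      case 3 then show ?thesis using VS1_adj by blast
    next
      case 4 then show ?thesis using VS1_adj[of i u] by (auto simp: insert_commute)
    next
      case 5 then show ?thesis using VS2_adj by blast
    next
      case 6 then show ?thesis using VS2_adj[of i u] by (auto simp: insert_commute)
    next
      case 7 then show ?thesis using VS3 by blast
    qed
  qed
  from W show ?thesis
  proof
    assume c: "clique (w ` B) (edges H)"
    have "{w (b i), w (b j)} \<in> edges H \<longleftrightarrow> i \<noteq> j" if "i < q" "j < q" for i j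
      using c that bB loop b_eq[OF that] w_eq[OF bB bB, OF that] by (auto simp: clique_def)
    then have VS3_adj: "{g u, g v} \<in> edges H \<longleftrightarrow> u \<noteq> v" if "u \<in> VS3 ` {..<q}" "v \<in> VS3 ` {..<q}" for u v
      using that loop by auto
    have "{g u, g v} \<in> edges H \<longleftrightarrow> {u, v} \<in> edges (F_K p q)" if "u \<in> ?V" "v \<in> ?V" for u v
      using adj[OF that] VS3_adj[of u v] F_K_shape(3)[of u v p q] by blast
    then have "\<not> free_of (F_K p q) H"
      using inj sub by (intro not_free_of_embedding[of g]) (simp_all only: F_K_shape(2))
    then show ?thesis ..
  next
    assume i: "indep (w ` B) (edges H)"
    \<comment> \<open>\<open>indep\<close> speaks of distinct vertices only; for
      \<open>w x = w y\<close> the pair collapses to a singleton, which is never an edge.\<close>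
    have "{w x, w y} \<notin> edges H" if "x \<in> B" "y \<in> B" for x y
      using i that loop[of "w x"] by (cases "w x = w y") (auto simp: indep_def)
    then have "{g u, g v} \<notin> edges H" if "u \<in> VS3 ` {..<q}" "v \<in> VS3 ` {..<q}" for u v
      using that bB by auto
    then have "{g u, g v} \<in> edges H \<longleftrightarrow> {u, v} \<in> edges (F_S p q)" if "u \<in> ?V" "v \<in> ?V" for u v
      using adj[OF that] by blast
    then have "\<not> free_of (F_S p q) H"
      using inj sub by (intro not_free_of_embedding[of g])
    then show ?thesis ..
  qed
qed

section \<open>Cuts determined by sets of bounded size\<close>

text \<open>Here \<open>K\<close> stands for the small set of private neighbours, not for the clique
  to be separated. Since no vertex is adjacent to itself, \<open>K - {v}\<close> is what allows
  members of \<open>K\<close> to lie on this side.\<close>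

definition cut_side :: "'a ugraph \<Rightarrow> 'a set \<Rightarrow> 'a set \<Rightarrow> 'a set \<Rightarrow> 'a set" where
  "cut_side H K A T = {v \<in> verts H. (\<forall>k\<in>K - {v}. {v, k} \<in> edges H) \<and>
     ((\<exists>a\<in>A. {a, v} \<in> edges H) \<or>
      (\<exists>w\<in>verts H. {v, w} \<in> edges H \<and> (\<forall>x\<in>A \<union> K \<union> T. {x, w} \<notin> edges H)))}"

definition nbhd :: "'a ugraph \<Rightarrow> 'a set \<Rightarrow> 'a set" where
  "nbhd H Y = {v \<in> verts H. \<exists>y\<in>Y. {y, v} \<in> edges H}"

text \<open>Each alternative names a cut that depends on \<open>K\<close> and \<open>S\<close> only
  through one vertex or through sets of size at most \<open>p\<close> or \<open>r\<close>, so
  polynomially many cuts suffice. The Ramsey number \<open>r\<close> enters by a hypothesis, so that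
  one \<open>r\<close> serves all graphs.\<close>

lemma separating_cut_exists:
  fixes H :: "'a ugraph"
  assumes ram: "\<forall>(V :: 'a set) E. finite V \<and> r \<le> card V \<longrightarrow>
      (\<exists>R\<subseteq>V. card R = q \<and> (clique R E \<or> indep R E))"
    and HF: "H \<in> F_class p q"
    and K: "clique_in H K" and S: "stable_in H S" and KS: "K \<inter> S = {}"
  shows "(\<exists>k\<in>verts H. K \<subseteq> insert k (nbhd H {k}) \<and> S \<inter> insert k (nbhd H {k}) = {}) \<or>
    (\<exists>Y\<subseteq>verts H. card Y \<le> p \<and> K \<subseteq> nbhd H Y \<and> S \<inter> nbhd H Y = {}) \<or>
    (\<exists>L\<subseteq>verts H. \<exists>A\<subseteq>verts H. \<exists>T\<subseteq>verts H. card L \<le> p \<and> card A \<le> p \<and> card T \<le> r \<and>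
      K \<subseteq> cut_side H L A T \<and> S \<inter> cut_side H L A T = {})"
proof -
  have H: "simple_graph H" using HF by (simp add: F_class_def)
  have finV: "finite (verts H)" using H by (simp add: simple_graph_def)
  have KV: "K \<subseteq> verts H" and SV: "S \<subseteq> verts H"
    using K S by (auto simp: clique_in_def stable_in_def)
  have finS: "finite S" using SV finV finite_subset by blast
  have K_adj: "{u, v} \<in> edges H" if "u \<in> K" "v \<in> K" "u \<noteq> v" for u v
    using K that by (auto simp: clique_in_def clique_def)
  have loop: "{u} \<notin> edges H" for u
    using H by (auto simp: simple_graph_def nsets_def)
  have S_adj: "{u, v} \<notin> edges H" if "u \<in> S" "v \<in> S" for u v
    using S that loop[of u] by (cases "u = v") (auto simp: stable_in_def indep_def)
  show ?thesis
  proof (cases "\<exists>k\<in>K. \<forall>s\<in>S. {s, k} \<notin> edges H")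
    case True
    then obtain k where k: "k \<in> K" "\<forall>s\<in>S. {s, k} \<notin> edges H" by blast
    have "K \<subseteq> insert k (nbhd H {k})" using K_adj k(1) KV by (auto simp: nbhd_def)
    moreover have "S \<inter> insert k (nbhd H {k}) = {}"
      using k KS by (auto simp: nbhd_def insert_commute)
    ultimately show ?thesis using k(1) KV by (intro disjI1 bexI[of _ k]) auto
  next
    case False
    obtain Y h where Y: "Y \<subseteq> S"
      and dom: "\<And>k s. k \<in> K \<Longrightarrow> s \<in> S \<Longrightarrow> {s, k} \<in> edges H \<Longrightarrow> \<exists>y\<in>Y. {y, k} \<in> edges H"
      and hK: "\<And>y. y \<in> Y \<Longrightarrow> h y \<in> K"
      and priv: "\<And>y y'. y \<in> Y \<Longrightarrow> y' \<in> Y \<Longrightarrow> {y', h y} \<in> edges H \<longleftrightarrow> y' = y"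
      by (rule minimal_dominating_subset[OF finS, of K "\<lambda>s k. {s, k} \<in> edges H"]) blast
    have domY: "\<exists>y\<in>Y. {y, k} \<in> edges H" if "k \<in> K" for k
      using False dom that by blast
    show ?thesis
    proof (cases "card Y \<le> p")
      case True
      have "K \<subseteq> nbhd H Y" using domY KV by (auto simp: nbhd_def)
      moreover have "S \<inter> nbhd H Y = {}" using S_adj Y by (auto simp: nbhd_def)
      ultimately show ?thesis using True Y SV
        by (intro disjI2[OF disjI1] exI[of _ Y] conjI) auto
    next
      case False
      then have "p \<le> card Y" by simp
      then obtain A where A: "A \<subseteq> Y" "card A = p"
        by (rule obtain_subset_with_card_n)
      have finA: "finite A" by (rule finite_subset[OF _ finS]) (use A(1) Y in blast)
      have AS: "A \<subseteq> S" using A(1) Y by blast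
      \<comment> \<open>In a copy of an excluded graph with \<open>A\<close> as $S_1$ and
        \<open>L\<close> as $K$, the vertices of \<open>T\<close> are the candidates for $S_2$ and
        those of \<open>W\<close> the candidates for $S_3$.\<close>
      define L where "L = h ` A"
      define W where "W = {w \<in> verts H. \<forall>x\<in>A \<union> L. {x, w} \<notin> edges H}"
      define T where "T = {s \<in> S - A. \<forall>x\<in>L. {s, x} \<in> edges H}"
      have TS: "T \<subseteq> S" by (auto simp: T_def)
      then have "finite T" using finS by (rule finite_subset)
      then obtain T' m where T': "T' \<subseteq> T"
        and domT: "\<And>w t. w \<in> W \<Longrightarrow> t \<in> T \<Longrightarrow> {t, w} \<in> edges H \<Longrightarrow> \<exists>t'\<in>T'. {t', w} \<in> edges H"
        and mW: "\<And>t. t \<in> T' \<Longrightarrow> m t \<in> W"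
        and mpriv: "\<And>t t'. t \<in> T' \<Longrightarrow> t' \<in> T' \<Longrightarrow> {t', m t} \<in> edges H \<longleftrightarrow> t' = t"
        by (rule minimal_dominating_subset[of T W "\<lambda>s k. {s, k} \<in> edges H"]) blast
      have finT': "finite T'" using T' \<open>finite T\<close> by (rule finite_subset)
      have "card T' \<le> r"
      proof (rule ccontr)
        assume "\<not> card T' \<le> r"
        \<comment> \<open>Ramsey is applied to the private neighbours of \<open>T'\<close>, as
          \<open>T'\<close> itself is stable. Injectivity of \<open>m\<close> keeps their number and
          lets \<open>R\<close> be pulled back to a set \<open>B\<close> of \<open>q\<close>
          vertices of \<open>T'\<close>.\<close>
        have injm: "inj_on m T'" by (rule inj_onI) (metis mpriv)
        then have "r \<le> card (m ` T')" using \<open>\<not> card T' \<le> r\<close> by (simp add: card_image)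
        then obtain R where R: "R \<subseteq> m ` T'" "card R = q"
          "clique R (edges H) \<or> indep R (edges H)"
          using ram finT' by blast
        obtain B where B: "B \<subseteq> T'" "R = m ` B" using R(1) by (auto simp: subset_image_iff)
        have cB: "card B = q"
          using R(2) B injm by (metis card_image inj_on_subset)
        have BS: "B \<subseteq> S" and BA: "B \<inter> A = {}" using B T' by (auto simp: T_def)
        have "stable_in H (A \<union> B)"
          using S AS BS unfolding stable_in_def indep_def by blast
        moreover have "{h a, h a'} \<in> edges H" if "a \<in> A" "a' \<in> A" "a \<noteq> a'" for a a'
        proof (rule K_adj)
          show "h a \<in> K" "h a' \<in> K" using hK that A by auto
          show "h a \<noteq> h a'" using priv[of a a] priv[of a' a] that A(1) by (metis subsetD)
        qed
        moreover have "{b, h a} \<in> edges H" if "a \<in> A" "b \<in> B" for a b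
          using that B T' by (auto simp: T_def L_def)
        moreover have "{a, m b} \<notin> edges H" "{h a, m b} \<notin> edges H" if "a \<in> A" "b \<in> B" for a b
          using mW[of b] that B(1) by (auto simp: W_def L_def)
        moreover have "{a', h a} \<in> edges H \<longleftrightarrow> a' = a" if "a \<in> A" "a' \<in> A" for a a'
          using that A(1) priv by blast
        moreover have "{b', m b} \<in> edges H \<longleftrightarrow> b' = b" if "b \<in> B" "b' \<in> B" for b b'
          using that B(1) mpriv by blast
        ultimately have "\<not> free_of (F_S p q) H \<or> \<not> free_of (F_K p q) H"
          using F_S_or_F_K_embeds[of H A B p q h m] H BA A(2) cB R(3) B(2) by blast
        then show False using HF by (auto simp: F_class_def)
      qed
      moreover have "K \<subseteq> cut_side H L A T'"
      proof
        fix v assume v: "v \<in> K"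
        have "{v, x} \<in> edges H" if "x \<in> L - {v}" for x
          using that K_adj[OF v] hK A(1) by (auto simp: L_def)
        moreover obtain y where y: "y \<in> Y" "{y, v} \<in> edges H" using domY v by blast
        \<comment> \<open>If \<open>y\<close> is in \<open>A\<close>, the first disjunct of
          \<open>cut_side\<close> holds. Otherwise \<open>y\<close> itself is the witness for the
          second: it sees no member of \<open>L\<close>, each being private to a vertex of
          \<open>A\<close>, and none of \<open>A \<union> T'\<close>, as \<open>S\<close> is
          stable.\<close>
        moreover have "{x, y} \<notin> edges H" if "y \<notin> A" "x \<in> A \<union> L \<union> T'" for x
        proof (cases "x \<in> L")
          case True
          then obtain a where a: "a \<in> A" "x = h a" by (auto simp: L_def)
          then show ?thesis using priv[of a y] y(1) A(1) that(1) by (auto simp: insert_commute)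
        next
          case False
          then have "x \<in> S" "y \<in> S" using that(2) AS T' TS Y y(1) by blast+
          then show ?thesis by (rule S_adj)
        qed
        moreover have "y \<in> verts H" "v \<in> verts H" using y(1) Y SV v KV by blast+
        moreover have "{v, y} \<in> edges H" using y(2) by (simp add: insert_commute)
        ultimately show "v \<in> cut_side H L A T'"
          unfolding cut_side_def by blast
      qed
      moreover have "s \<notin> cut_side H L A T'" if s: "s \<in> S" for s
      proof
        assume cut: "s \<in> cut_side H L A T'"
        have "s \<notin> L" using s hK A(1) KS by (auto simp: L_def)
        then have sL: "\<forall>x\<in>L. {s, x} \<in> edges H" using cut by (auto simp: cut_side_def)
        have "\<not> (\<exists>a\<in>A. {a, s} \<in> edges H)" using AS S_adj s by blast
        then obtain w where w: "w \<in> verts H" "{s, w} \<in> edges H"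
          "\<forall>x\<in>A \<union> L \<union> T'. {x, w} \<notin> edges H"
          using cut by (auto simp: cut_side_def)
        \<comment> \<open>That \<open>s\<close> lies outside \<open>A\<close> comes from its edge to
          \<open>w\<close>, which has no neighbour in \<open>A\<close>. By \<open>domT\<close>,
          \<open>w\<close> then has a neighbour in \<open>T'\<close>, which the choice of
          \<open>w\<close> forbids.\<close>
        then have "w \<in> W" "s \<in> T" using s sL by (auto simp: W_def T_def)
        then show False using domT w by blast
      qed
      moreover have "card L \<le> p" using card_image_le[OF finA, of h] A(2) by (simp add: L_def)
      moreover have "L \<subseteq> verts H" using hK A(1) KV by (auto simp: L_def)
      ultimately show ?thesis using A AS SV T' TS
        by (intro disjI2 exI[of _ L] exI[of _ A] exI[of _ T'] conjI) auto
    qed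
  qed
qed

section \<open>The number of small subsets\<close>

text \<open>A set of at most \<open>m\<close> elements is the set of entries of a list of length at
  most \<open>m\<close>. The lists are counted by a geometric sum, which the next power bounds
  because the base is at least 2.\<close>

lemma small_subsets:
  assumes "finite V" and "2 \<le> card V"
  shows "finite {A. A \<subseteq> V \<and> card A \<le> m}" and "card {A. A \<subseteq> V \<and> card A \<le> m} \<le> card V ^ Suc m"
proof -
  let ?L = "{xs. set xs \<subseteq> V \<and> length xs \<le> m}"
  have fin: "finite ?L" using assms(1) by (rule finite_lists_length_le)
  show "finite {A. A \<subseteq> V \<and> card A \<le> m}" using assms(1) by auto
  have "{A. A \<subseteq> V \<and> card A \<le> m} \<subseteq> set ` ?L"
  proof
    fix A assume A: "A \<in> {A. A \<subseteq> V \<and> card A \<le> m}"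
    then obtain xs where "set xs = A" "distinct xs"
      using assms(1) finite_distinct_list[of A] finite_subset by blast
    then show "A \<in> set ` ?L" using A by (force simp: distinct_card)
  qed
  then have "card {A. A \<subseteq> V \<and> card A \<le> m} \<le> card ?L"
    using fin by (meson card_image_le card_mono finite_imageI le_trans)
  also have "\<dots> = (\<Sum>i\<le>m. card V ^ i)" using assms(1) by (rule card_lists_length_le)
  also have "\<dots> \<le> card V ^ Suc m"
  proof (induction m)
    case 0 then show ?case using assms(2) by simp
  next
    case (Suc m)
    have "(\<Sum>i\<le>Suc m. card V ^ i) \<le> 2 * card V ^ Suc m" using Suc by simp
    also have "\<dots> \<le> card V * card V ^ Suc m" using assms(2) by (rule mult_le_mono1)
    finally show ?case by simp
  qed
  finally show "card {A. A \<subseteq> V \<and> card A \<le> m} \<le> card V ^ Suc m" .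
qed

section \<open>Complements and induced subgraphs\<close>

lemma complement_induced:
  assumes "A \<subseteq> verts G"
  shows "complement (induced G A) = induced (complement G) A"
  using assms by (auto simp: complement_def induced_def nsets_def)

lemma free_of_induced:
  assumes "free_of F G" "A \<subseteq> verts G"
  shows "free_of F (induced G A)"
proof -
  have "induced (induced G A) B = induced G B" if "B \<subseteq> A" for B
    using that by (auto simp: induced_def)
  then show ?thesis using assms by (auto simp: free_of_def induced_def)
qed

lemma simple_graph_induced: "simple_graph G \<Longrightarrow> A \<subseteq> verts G \<Longrightarrow> simple_graph (induced G A)"
  by (auto simp: simple_graph_def induced_def nsets_def intro: finite_subset)

lemma hereditary_complement_F_class:
  "hereditary {G. simple_graph G \<and> complement G \<in> F_class p q}"
proof -
  have [simp]: "verts (complement G) = verts G" for G :: "'a ugraph" by (simp add: complement_def)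
  show ?thesis
    by (auto simp: hereditary_def F_class_def complement_induced free_of_induced
        simple_graph_induced simp del: fst_conv)
qed

lemma clique_in_complement: "clique_in G K \<Longrightarrow> stable_in (complement G) K"
  by (auto simp: clique_in_def stable_in_def complement_def clique_def indep_def nsets_def
      card_insert_if split: if_splits)

lemma stable_in_complement: "stable_in G S \<Longrightarrow> clique_in (complement G) S"
  by (auto simp: clique_in_def stable_in_def complement_def clique_def indep_def nsets_def
      card_insert_if subset_iff)

section \<open>Counting the cuts and returning to the original graph\<close>

theorem theorem1p2:
  fixes p q :: nat
  assumes "p > 0" and "q > 0"
  shows "clique_stable_separation {G :: 'a ugraph. simple_graph G \<and> complement G \<in> F_class p q}"
proof -
  obtain r where ram: "\<forall>(V :: 'a set) E. finite V \<and> r \<le> card V \<longrightarrow>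
      (\<exists>R\<subseteq>V. card R = q \<and> (clique R E \<or> indep R E))"
    using ramsey2[of q q] by metis
  define d where "d = Suc (p + r)"
  have "\<exists>P \<subseteq> bipartitions (verts G). card P \<le> card (verts G) ^ (3 * d + 2) \<and>
      (\<forall>K S. clique_in G K \<and> stable_in G S \<and> K \<inter> S = {} \<longrightarrow>
         (\<exists>(X, Y)\<in>P. K \<subseteq> X \<and> S \<subseteq> Y))"
    if GF: "complement G \<in> F_class p q" and G: "simple_graph G" and n: "2 \<le> card (verts G)"
    for G :: "'a ugraph"
  proof -
    let ?H = "complement G" and ?V = "verts G"
    have VH [simp]: "verts ?H = ?V" by (simp add: complement_def)
    have finV: "finite ?V" using G by (simp add: simple_graph_def)
    \<comment> \<open>The bound \<open>p + r\<close> covers all the sets occurring in the cuts,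
      those of size at most \<open>p\<close> and those of size at most \<open>r\<close>, so one
      family suffices.\<close>
    define I where "I = {A. A \<subseteq> ?V \<and> card A \<le> p + r}"
    have finI: "finite I" and cardI: "card I \<le> card ?V ^ d"
      using small_subsets[OF finV n] unfolding I_def d_def by blast+
    define C1 where "C1 = (\<lambda>k. insert k (nbhd ?H {k})) ` ?V"
    define C2 where "C2 = nbhd ?H ` I"
    define C3 where "C3 = (\<lambda>(L, A, T). cut_side ?H L A T) ` (I \<times> I \<times> I)"
    \<comment> \<open>In the complement \<open>S\<close> is the clique and \<open>K\<close> the
      stable set, so a cut contains \<open>S\<close> and becomes the second component.\<close>
    define P where "P = (\<lambda>X. (?V - X, X)) ` (C1 \<union> C2 \<union> C3)"
    have fin: "finite C1" "finite C2" "finite C3"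
      using finV finI by (auto simp: C1_def C2_def C3_def)
    have C_sub: "X \<subseteq> ?V" if "X \<in> C1 \<union> C2 \<union> C3" for X
      using that by (auto simp: C1_def C2_def C3_def nbhd_def cut_side_def complement_def)
    then have "P \<subseteq> bipartitions ?V" by (auto simp: P_def bipartitions_def)
    moreover have "card P \<le> card ?V ^ (3 * d + 2)"
    proof -
      have pw: "card ?V ^ i \<le> card ?V ^ (3 * d)" if "i \<le> 3 * d" for i
        using n that by (intro power_increasing) auto
      have "card C1 \<le> card ?V ^ (3 * d)"
        using card_image_le[OF finV] pw[of 1] unfolding C1_def d_def by (force intro: le_trans)
      moreover have "card C2 \<le> card ?V ^ (3 * d)"
        using card_image_le[OF finI, of "nbhd ?H"] cardI pw[of d] unfolding C2_def by linarith
      moreover have "card C3 \<le> card ?V ^ (3 * d)"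
      proof -
        have "card C3 \<le> card (I \<times> I \<times> I)"
          unfolding C3_def using finI by (intro card_image_le) auto
        also have "\<dots> = card I ^ 3" by (simp add: card_cartesian_product power3_eq_cube)
        also have "\<dots> \<le> (card ?V ^ d) ^ 3" using cardI by (rule power_mono) simp
        finally show ?thesis by (simp add: power_mult mult.commute)
      qed
      moreover have "card P \<le> card C1 + card C2 + card C3"
      proof -
        have "card P \<le> card (C1 \<union> C2 \<union> C3)"
          unfolding P_def using fin by (intro card_image_le) auto
        then show ?thesis using card_Un_le[of "C1 \<union> C2" C3] card_Un_le[of C1 C2] by linarith
      qed
      \<comment> \<open>The exponent \<open>3 * d\<close> comes from the triples in
        \<open>C3\<close>. The factor 3 for the three families is rounded up to 4, which is absorbed
        by two further powers of the number of vertices, as this is at least 2.\<close>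
      ultimately have "card P \<le> 2\<^sup>2 * card ?V ^ (3 * d)" by simp
      also have "\<dots> \<le> (card ?V)\<^sup>2 * card ?V ^ (3 * d)"
        using n by (intro mult_le_mono1 power_mono) auto
      finally show ?thesis by (simp add: power_add mult.commute power2_eq_square)
    qed
    moreover have "\<exists>(X, Y)\<in>P. K \<subseteq> X \<and> S \<subseteq> Y"
      if "clique_in G K" "stable_in G S" "K \<inter> S = {}" for K S
    proof -
      have "S \<inter> K = {}" using that(3) by blast
      note cut = separating_cut_exists[OF ram GF stable_in_complement[OF that(2)]
          clique_in_complement[OF that(1)] this]
      have "\<exists>X\<in>C1 \<union> C2 \<union> C3. S \<subseteq> X \<and> K \<inter> X = {}"
        using cut[unfolded VH]
      proof (elim disjE bexE exE conjE)
        fix k assume "k \<in> ?V" "S \<subseteq> insert k (nbhd ?H {k})" "K \<inter> insert k (nbhd ?H {k}) = {}"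
        then show ?thesis unfolding C1_def by blast
      next
        fix Y assume "Y \<subseteq> ?V" "card Y \<le> p" "S \<subseteq> nbhd ?H Y" "K \<inter> nbhd ?H Y = {}"
        moreover from this have "Y \<in> I" by (auto simp: I_def)
        ultimately show ?thesis unfolding C2_def by blast
      next
        fix L A T assume *: "L \<subseteq> ?V" "A \<subseteq> ?V" "T \<subseteq> ?V" "card L \<le> p" "card A \<le> p" "card T \<le> r"
          "S \<subseteq> cut_side ?H L A T" "K \<inter> cut_side ?H L A T = {}"
        then have "cut_side ?H L A T \<in> C3" by (force simp: C3_def I_def)
        then show ?thesis using * by blast
      qed
      then obtain X where X: "X \<in> C1 \<union> C2 \<union> C3" "S \<subseteq> X" "K \<inter> X = {}" by blast
      then have "(?V - X, X) \<in> P" unfolding P_def by blast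
      moreover have "K \<subseteq> ?V - X" using that(1) X(3) by (auto simp: clique_in_def)
      ultimately show ?thesis using X(2) by blast
    qed
    ultimately show ?thesis by blast
  qed
  then show ?thesis
    unfolding clique_stable_separation_def
    by (intro conjI hereditary_complement_F_class exI[of _ "3 * d + 2"]) simp
qed

end
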